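(* Let $f:\mathbb{R}^d\to\mathbb{R}$ be continuous with a unique $x^*\in\mathbb{R}^d$ such that $f(x^* )=\min f=:\underline f$; assume there is $L_f>0$ with $|f(x)-f(y)|\le L_f(1+|x|+|y|)|x-y|$ for all $x,y\in\mathbb{R}^d$, and there are $c_\ell,c_u,M>0$ with $f(x)-\underline f\le c_u(|x|^2+1)$ for all $x\in\mathbb{R}^d$ and $c_\ell|x|^2\le f(x)-\underline f$ for $|x|\ge M$. Let $\lambda,\delta>0$. Let $x_0\in\mathbb{R}^d$ be arbitrary, and let $\{x_k^{CH}\}_{k\in\mathbb N}$ be the solution of the Consensus Hopping scheme with initial datum $x_0$ and $\tilde\sigma=\tfrac{\delta}{\sqrt{2\lambda}}$. For $k\in\mathbb N$ let $\nu_k^\alpha=\mathcal N(x_k^{CH},\tfrac{\delta^2}{2\lambda}I_d)$. Then, for any $\gamma\in(0,1)$ and for $\alpha$ sufficiently large, $$W_2(\nu_k^\alpha,\boldsymbol\rho_\infty^\alpha)\le C_\alpha\gamma^k\quad\text{for all }k\in\mathbb N,$$ for some $C_\alpha>0$ depending on $\alpha$, where $\boldsymbol\rho_\infty^\alpha=\mathcal N(\boldsymbol\mu_\infty^\alpha,\tfrac{\delta^2}{2\lambda}I_d)$ and, for any fixed $r>0$ and $\alpha$ sufficiently large, $\boldsymbol\mu_\infty^\alpha$ is the unique fixed point in $B_r(x^* )$ of the map $\mathcal T^\alpha(\mu)=X^\alpha(\mathcal N(\mu,\tfrac{\delta^2}{2\lambda}I_d))$.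
   Context: For a probability measure $\rho$ on $\mathbb{R}^d$ and $\alpha>0$, the consensus point is $X^\alpha(\rho)=\frac{\int x e^{-\alpha f(x)}d\rho(x)}{\int e^{-\alpha f(x)}d\rho(x)}$. $W_2$ is the 2-Wasserstein distance. Consensus Hopping scheme: $x_0^{CH}=x_0$, $x_k^{CH}=X^\alpha\big(\mathcal N(x_{k-1}^{CH},\tilde\sigma^2I_d)\big)$ for $k\ge1$. For any fixed $r>0$ and $\alpha$ sufficiently large (depending on $r$), $\mathcal T^\alpha$ is a contraction of the closed ball $B_r(x^* )$ into itself; $\boldsymbol\mu_\infty^\alpha$ denotes its unique fixed point in $B_r(x^* )$ (for $\alpha$ large it does not depend on the chosen $r$). *)

theory Defs
  imports "HOL-Probability.Probability"
begin

text \<open>\<open>gaussian m v\<close> is the normal law with mean \<open>m\<close> and covariance matrix \<open>v I\<close>;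
  \<open>v\<close> is the variance, in contrast to \<^const>\<open>normal_density\<close>, which takes the standard deviation.\<close>

definition gaussian :: "'a::euclidean_space \<Rightarrow> real \<Rightarrow> 'a measure" where
  "gaussian m v = density lborel
     (\<lambda>x. ennreal (exp (- (norm (x - m))\<^sup>2 / (2 * v)) / (sqrt (2 * pi * v)) ^ DIM('a)))"

definition consensus_point :: "('a::euclidean_space \<Rightarrow> real) \<Rightarrow> real \<Rightarrow> 'a measure \<Rightarrow> 'a" where
  "consensus_point f \<alpha> \<rho> =
     (\<integral>x. exp (- \<alpha> * f x) *\<^sub>R x \<partial>\<rho>) /\<^sub>R (\<integral>x. exp (- \<alpha> * f x) \<partial>\<rho>)"

definition consensus_map :: "('a::euclidean_space \<Rightarrow> real) \<Rightarrow> real \<Rightarrow> real \<Rightarrow> 'a \<Rightarrow> 'a" where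
  "consensus_map f v \<alpha> m = consensus_point f \<alpha> (gaussian m v)"

primrec consensus_hopping ::
    "('a::euclidean_space \<Rightarrow> real) \<Rightarrow> real \<Rightarrow> real \<Rightarrow> 'a \<Rightarrow> nat \<Rightarrow> 'a" where
  "consensus_hopping f \<sigma> \<alpha> x\<^sub>0 0 = x\<^sub>0"
| "consensus_hopping f \<sigma> \<alpha> x\<^sub>0 (Suc k) =
     consensus_point f \<alpha> (gaussian (consensus_hopping f \<sigma> \<alpha> x\<^sub>0 k) (\<sigma>\<^sup>2))"

definition couplings :: "'a measure \<Rightarrow> 'b measure \<Rightarrow> ('a \<times> 'b) measure set" where
  "couplings \<mu> \<nu> =
     {\<pi>. sets \<pi> = sets (\<mu> \<Otimes>\<^sub>M \<nu>) \<and> distr \<pi> \<mu> fst = \<mu> \<and> distr \<pi> \<nu> snd = \<nu>}"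

text \<open>The library has no square root on \<^typ>\<open>ennreal\<close>, and \<^const>\<open>enn2real\<close> maps the
  infinite value to 0; hence the case distinction.\<close>

definition wasserstein2 :: "'a::euclidean_space measure \<Rightarrow> 'a measure \<Rightarrow> ennreal" where
  "wasserstein2 \<mu> \<nu> =
     (let c = (INF \<pi>\<in>couplings \<mu> \<nu>. \<integral>\<^sup>+ (x, y). ennreal ((dist x y)\<^sup>2) \<partial>\<pi>)
      in if c = \<infinity> then \<infinity> else ennreal (sqrt (enn2real c)))"

end

theory Submission
  imports Defs
begin

text \<open>Completing the square, \<open>T(m) - xs\<close> is the mean of \<open>x - xs\<close> under the weight
  \<open>exp (- \<alpha> (f x - f xs) - |x - xs|\<^sup>2 / 2v + (x - xs) \<bullet> (m - xs) / v)\<close>. The derivative of such a tilted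
  mean in \<open>m\<close> is the covariance divided by \<open>v\<close>, and as \<open>\<alpha> \<rightarrow> \<infinity>\<close> the first two moments vanish
  uniformly for \<open>m\<close> in a ball, by Laplace's method. So on every ball about \<open>xs\<close> the map is a
  contraction with arbitrarily small constant into an arbitrarily small ball; taking a ball that
  contains \<open>x\<^sub>0\<close>, Banach's theorem gives geometric convergence of the means, and translating one
  Gaussian onto the other is a coupling of cost the squared distance of the means.\<close>

section \<open>Gaussian measures\<close>

text \<open>Factorising over the coordinates reduces the total mass to one-dimensional normal
  integrals. The factors have standard deviation \<open>sqrt v\<close>, since \<open>v\<close> is a
  variance.\<close>

lemma gaussian_density_eq_prod:
  fixes x m :: "'a::euclidean_space"
  assumes "v > 0"
  shows "exp (- (norm (x - m))\<^sup>2 / (2 * v)) / (sqrt (2 * pi * v)) ^ DIM('a)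
    = (\<Prod>b\<in>Basis. normal_density (m \<bullet> b) (sqrt v) (x \<bullet> b))"
proof -
  have "(norm (x - m))\<^sup>2 = (\<Sum>b\<in>Basis. (x \<bullet> b - m \<bullet> b)\<^sup>2)"
    unfolding power2_norm_eq_inner
    by (subst euclidean_inner) (simp add: inner_diff_left power2_eq_square)
  then show ?thesis
    using assms
    by (simp add: normal_density_def prod_dividef exp_sum[symmetric] sum_divide_distrib
        sum_negf[symmetric])
qed

lemma prob_space_gaussian:
  fixes m :: "'a::euclidean_space"
  assumes "v > 0"
  shows "prob_space (gaussian m v)"
proof
  have "(\<integral>\<^sup>+x. ennreal (\<Prod>b\<in>Basis. normal_density (m \<bullet> b) (sqrt v) (x \<bullet> b)) \<partial>lborel)
      = (\<integral>\<^sup>+x. (\<Prod>b\<in>Basis. ennreal (normal_density (m \<bullet> b) (sqrt v) (x \<bullet> b))) \<partial>lborel)"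
    by (simp add: prod_ennreal)
  also have "\<dots> = (\<Prod>b\<in>(Basis :: 'a set). \<integral>\<^sup>+x. ennreal (normal_density (m \<bullet> b) (sqrt v) x) \<partial>lborel)"
    using nn_integral_lborel_prod[of "\<lambda>b::'a. normal_density (m \<bullet> b) (sqrt v)"] by simp
  also have "\<dots> = 1"
    using assms by (simp add: nn_integral_eq_integral normal_density_nonneg)
  finally have "(\<integral>\<^sup>+x. ennreal (\<Prod>b\<in>Basis. normal_density (m \<bullet> b) (sqrt v) (x \<bullet> b)) \<partial>lborel) = 1" .
  then show "emeasure (gaussian m v) (space (gaussian m v)) = 1"
    by (simp only: gaussian_def emeasure_density gaussian_density_eq_prod[OF assms] space_density)
       (simp add: emeasure_density)
qed

lemma sets_gaussian [measurable_cong, simp]: "sets (gaussian m v) = sets borel"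
  by (simp add: gaussian_def)

lemma space_gaussian [simp]: "space (gaussian m v) = UNIV"
  by (simp add: gaussian_def)

text \<open>Read off from the total mass: the constant 1 is integrable for the probability measure
  \<open>gaussian m v\<close>, and unfolding its density leaves this function up to the normalising
  constant.\<close>

lemma integrable_exp_neg_norm_sq:
  fixes m :: "'a::euclidean_space"
  assumes "v > 0"
  shows "integrable lborel (\<lambda>x. exp (- (norm (x - m))\<^sup>2 / (2 * v)))"
proof -
  interpret prob_space "gaussian m v" by (rule prob_space_gaussian[OF assms])
  have "integrable (gaussian m v) (\<lambda>_. 1 :: real)" by simp
  then have "integrable lborel
      (\<lambda>x. exp (- (norm (x - m))\<^sup>2 / (2 * v)) / (sqrt (2 * pi * v)) ^ DIM('a))"
    unfolding gaussian_def using assms by (subst (asm) integrable_density) auto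
  then have "integrable lborel (\<lambda>x. sqrt (2 * pi * v) ^ DIM('a) *
      (exp (- (norm (x - m))\<^sup>2 / (2 * v)) / (sqrt (2 * pi * v)) ^ DIM('a)))"
    by (rule integrable_mult_right)
  then show ?thesis using assms by simp
qed

text \<open>Half of the quadratic decay absorbs both the polynomial factor and the linear exponent,
  so a Gaussian of doubled variance dominates.\<close>

lemma integrable_norm_power_exp_neg_norm_sq:
  fixes m :: "'a::euclidean_space"
  assumes "v > 0"
  shows "integrable lborel
    (\<lambda>x. norm (x - m) ^ j * exp (A * norm (x - m) - (norm (x - m))\<^sup>2 / (2 * v)))"
proof (rule Bochner_Integration.integrable_bound)
  \<comment> \<open>The power contributes \<open>j\<close> to the linear rate, because t \<le> exp t
    gives \<open>t ^ j \<le> exp (j * t)\<close>.\<close>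
  define B where "B = A + real j"
  show "integrable lborel (\<lambda>x. exp (v * B\<^sup>2) * exp (- (norm (x - m))\<^sup>2 / (2 * (2 * v))))"
    using integrable_exp_neg_norm_sq[of "2 * v" m] assms by simp
  have *: "t ^ j * exp (A * t - t\<^sup>2 / (2 * v)) \<le> exp (v * B\<^sup>2) * exp (- t\<^sup>2 / (2 * (2 * v)))"
    if "t \<ge> 0" for t
  proof -
    have "t ^ j \<le> exp t ^ j"
      using that exp_ge_add_one_self[of t] by (intro power_mono) linarith+
    then have "t ^ j * exp (A * t - t\<^sup>2 / (2 * v)) \<le> exp (real j * t) * exp (A * t - t\<^sup>2 / (2 * v))"
      by (simp add: exp_of_nat_mult)
    also have "\<dots> = exp (B * t - t\<^sup>2 / (2 * v))"
      by (simp add: exp_add[symmetric] B_def algebra_simps)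
    also have "\<dots> \<le> exp (v * B\<^sup>2 + - t\<^sup>2 / (2 * (2 * v)))"
    proof -
      \<comment> \<open>The gap between the two exponents is exactly this square.\<close>
      have "0 \<le> (t - 2 * v * B)\<^sup>2 / (4 * v)" using assms by simp
      also have "\<dots> = v * B\<^sup>2 + - t\<^sup>2 / (2 * (2 * v)) - (B * t - t\<^sup>2 / (2 * v))"
        using assms by (simp add: field_simps power2_eq_square)
      finally show ?thesis by simp
    qed
    finally show ?thesis by (simp only: exp_add)
  qed
  show "AE x in lborel.
      norm (norm (x - m) ^ j * exp (A * norm (x - m) - (norm (x - m))\<^sup>2 / (2 * v)))
      \<le> norm (exp (v * B\<^sup>2) * exp (- (norm (x - m))\<^sup>2 / (2 * (2 * v))))"
    using *[OF norm_ge_zero[of "_ - m"]] by (simp add: abs_mult)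
qed auto

section \<open>Wasserstein distance of two translates\<close>

text \<open>Lebesgue measure is translation invariant, so a shift only moves the centre in the
  density.\<close>

lemma distr_gaussian_plus: "distr (gaussian m v) borel ((+) c) = gaussian (c + m) v"
proof -
  have "gaussian (c + m) v = density (distr lborel borel ((+) c))
     (\<lambda>x. ennreal (exp (- (norm (x - (c + m)))\<^sup>2 / (2 * v)) / (sqrt (2 * pi * v)) ^ DIM('a)))"
    by (simp add: gaussian_def lborel_distr_plus)
  also have "\<dots> = distr (gaussian m v) borel ((+) c)"
    by (subst density_distr) (simp_all add: gaussian_def)
  finally show ?thesis ..
qed

text \<open>This turns convergence of the means into convergence of the laws.\<close>

lemma wasserstein2_gaussian_le_dist:
  fixes a b :: "'a::euclidean_space"
  assumes "v > 0"
  shows "wasserstein2 (gaussian a v) (gaussian b v) \<le> ennreal (dist a b)"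
proof -
  interpret prob_space "gaussian a v" by (rule prob_space_gaussian[OF assms])
  \<comment> \<open>Every point moves by the same vector \<open>b - a\<close>, so the transport cost
    is constant in \<open>x\<close>.\<close>
  define \<pi> where "\<pi> = distr (gaussian a v) (gaussian a v \<Otimes>\<^sub>M gaussian b v) (\<lambda>x. (x, (b - a) + x))"
  have meas [measurable]:
    "(\<lambda>x. (x, (b - a) + x)) \<in> gaussian a v \<rightarrow>\<^sub>M gaussian a v \<Otimes>\<^sub>M gaussian b v"
    by measurable
  have "\<pi> \<in> couplings (gaussian a v) (gaussian b v)"
  proof -
    have "distr \<pi> (gaussian a v) fst = distr (gaussian a v) (gaussian a v) (\<lambda>x. x)"
      unfolding \<pi>_def by (subst distr_distr) (auto simp: comp_def)
    moreover have "distr \<pi> (gaussian b v) snd = distr (gaussian a v) (gaussian b v) ((+) (b - a))"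
      unfolding \<pi>_def by (subst distr_distr) (auto simp: comp_def)
    moreover have "distr (gaussian a v) (gaussian b v) ((+) (b - a))
        = distr (gaussian a v) borel ((+) (b - a))"
      by (rule distr_cong) auto
    ultimately show ?thesis
      using distr_gaussian_plus[of a v "b - a"] by (simp add: couplings_def \<pi>_def)
  qed
  moreover have "(\<integral>\<^sup>+ (x, y). ennreal ((dist x y)\<^sup>2) \<partial>\<pi>) = ennreal ((dist a b)\<^sup>2)"
  proof -
    have [measurable]: "(\<lambda>(x, y). ennreal ((dist x y)\<^sup>2))
        \<in> borel_measurable (gaussian a v \<Otimes>\<^sub>M gaussian b v)"
      by measurable
    have "(\<integral>\<^sup>+ (x, y). ennreal ((dist x y)\<^sup>2) \<partial>\<pi>)
        = (\<integral>\<^sup>+ x. ennreal ((dist x ((b - a) + x))\<^sup>2) \<partial>gaussian a v)"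
      unfolding \<pi>_def by (subst nn_integral_distr) auto
    also have "\<dots> = ennreal ((dist a b)\<^sup>2)"
      using emeasure_space_1 by (simp add: dist_norm norm_minus_commute)
    finally show ?thesis .
  qed
  ultimately have le: "(INF \<pi>\<in>couplings (gaussian a v) (gaussian b v).
      \<integral>\<^sup>+ (x, y). ennreal ((dist x y)\<^sup>2) \<partial>\<pi>) \<le> ennreal ((dist a b)\<^sup>2)"
    (is "?c \<le> _")
    by (metis (no_types, lifting) INF_lower)
  \<comment> \<open>Finiteness selects the square root branch of \<open>wasserstein2\<close>, where
    \<open>enn2real\<close> loses nothing.\<close>
  then have "?c < \<infinity>"
    by (rule le_less_trans) simp
  moreover have "sqrt (enn2real ?c) \<le> dist a b"
    using enn2real_mono[OF le] by (simp add: real_le_lsqrt)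
  ultimately show ?thesis
    unfolding wasserstein2_def Let_def by (simp only: less_imp_neq if_False ennreal_leI)
qed

section \<open>Laplace concentration\<close>

lemma tendsto_nhds_of_continuous_on: "continuous_on UNIV g \<Longrightarrow> (g \<longlongrightarrow> g x) (nhds x)"
  by (metis UNIV_I continuous_on_def tendsto_at_iff_tendsto_nhds)

text \<open>A mean value estimate: the derivative of exp is at most \<open>exp c\<close> to the left
  of \<open>c\<close>. It serves to compare two weights through their exponents.\<close>

lemma abs_exp_diff_le:
  fixes a b :: real
  assumes "a \<le> c" "b \<le> c"
  shows "\<bar>exp a - exp b\<bar> \<le> \<bar>a - b\<bar> * exp c"
proof -
  have *: "exp y - exp z \<le> (y - z) * exp c" if "z \<le> y" "y \<le> c" for y z :: real
  proof -
    have "1 - exp (z - y) \<le> y - z" using exp_ge_add_one_self[of "z - y"] by linarith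
    then have "exp y * (1 - exp (z - y)) \<le> exp c * (y - z)"
      using that by (intro mult_mono) auto
    then show ?thesis by (simp add: right_diff_distrib exp_add[symmetric] mult.commute)
  qed
  show ?thesis using *[of a b] *[of b a] assms by (cases "a \<le> b") auto
qed

text \<open>\<open>separated\<close> is the quantitative form of uniqueness that Laplace's method
  uses. It also excludes values that approach the minimum at infinity.\<close>

locale strict_minimizer =
  fixes f :: "'a::euclidean_space \<Rightarrow> real" and xs :: 'a
  assumes cont: "continuous_on UNIV f"
    and minimum: "f xs \<le> f x"
    and separated: "\<rho> > 0 \<Longrightarrow> \<exists>\<eta>>0. \<forall>x. dist x xs \<ge> \<rho> \<longrightarrow> f xs + \<eta> \<le> f x"
begin

text \<open>Subtracting the minimum bounds the factor by 1 for \<alpha> \<ge> 0, so one dominating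
  function serves all such \<alpha>. The extra constant cancels in ratios.\<close>

definition gibbs :: "real \<Rightarrow> 'a \<Rightarrow> real" where
  "gibbs \<alpha> x = exp (- \<alpha> * (f x - f xs))"

lemma gibbs_measurable [measurable]: "gibbs \<alpha> \<in> borel_measurable borel"
  using borel_measurable_continuous_onI[OF cont] unfolding gibbs_def by measurable

lemma gibbs_pos: "gibbs \<alpha> x > 0"
  by (simp add: gibbs_def)

lemma gibbs_le_one: "\<alpha> \<ge> 0 \<Longrightarrow> gibbs \<alpha> x \<le> 1"
  using minimum[of x] by (simp add: gibbs_def)

lemma integrable_gibbs_mult:
  assumes "\<alpha> \<ge> 0" "integrable lborel h"
  shows "integrable lborel (\<lambda>x. h x * gibbs \<alpha> x)"
proof (rule Bochner_Integration.integrable_bound[OF assms(2)])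
  show "AE x in lborel. norm (h x * gibbs \<alpha> x) \<le> norm (h x)"
    using gibbs_le_one[OF assms(1)] less_imp_le[OF gibbs_pos[of \<alpha>]]
    by (auto simp: abs_mult intro!: mult_right_le_one_le)
  have [measurable]: "h \<in> borel_measurable borel" using assms(2) by auto
  show "(\<lambda>x. h x * gibbs \<alpha> x) \<in> borel_measurable lborel" by measurable
qed

text \<open>By continuity, a small ball about \<open>xs\<close> has \<open>f\<close> below
  \<open>f xs + \<eta>\<close> and \<open>k\<close> above half of \<open>k xs\<close>; that ball
  alone gives the bound. It is chosen before \<alpha>, so \<open>\<kappa>\<close> is independent of
  \<alpha>.\<close>

lemma integral_gibbs_lower_bound:
  assumes k: "continuous_on UNIV k" "\<And>x. k x > 0" "integrable lborel k" and "\<eta> > 0"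
  obtains \<kappa> where "\<kappa> > 0" "\<And>\<alpha>. \<alpha> \<ge> 0 \<Longrightarrow> \<kappa> * exp (- \<alpha> * \<eta>) \<le> (\<integral>x. k x * gibbs \<alpha> x \<partial>lborel)"
proof -
  have "\<forall>\<^sub>F x in nhds xs. f x < f xs + \<eta>"
    using assms(4) by (intro order_tendstoD(2)[OF tendsto_nhds_of_continuous_on[OF cont]]) simp
  moreover have "\<forall>\<^sub>F x in nhds xs. k xs / 2 < k x"
    using k(2)[of xs] by (intro order_tendstoD(1)[OF tendsto_nhds_of_continuous_on[OF k(1)]]) simp
  ultimately have "\<forall>\<^sub>F x in nhds xs. f x < f xs + \<eta> \<and> k xs / 2 < k x"
    by (rule eventually_conj)
  then obtain s where s: "s > 0" "\<And>x. dist x xs < s \<Longrightarrow> f x < f xs + \<eta> \<and> k xs / 2 < k x"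
    unfolding eventually_nhds_metric by blast
  define \<kappa> where "\<kappa> = k xs / 2 * measure lborel (ball xs s)"
  show thesis
  proof
    show "\<kappa> > 0" using content_ball_pos[OF s(1), of xs] k(2)[of xs] by (simp add: \<kappa>_def)
    fix \<alpha> :: real assume \<alpha>: "\<alpha> \<ge> 0"
    have int: "integrable lborel (indicator (ball xs s) :: 'a \<Rightarrow> real)"
      using emeasure_bounded_finite[OF bounded_ball] by (intro integrable_real_indicator) auto
    have "\<kappa> * exp (- \<alpha> * \<eta>)
        = (\<integral>x. indicator (ball xs s) x * (k xs / 2 * exp (- \<alpha> * \<eta>)) \<partial>lborel)"
      using int by (simp add: \<kappa>_def)
    also have "\<dots> \<le> (\<integral>x. k x * gibbs \<alpha> x \<partial>lborel)"
    proof (rule integral_mono)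
      show "integrable lborel (\<lambda>x. indicator (ball xs s) x * (k xs / 2 * exp (- \<alpha> * \<eta>)))"
        using int by simp
      show "integrable lborel (\<lambda>x. k x * gibbs \<alpha> x)"
        by (rule integrable_gibbs_mult[OF \<alpha> k(3)])
      fix x
      show "indicator (ball xs s) x * (k xs / 2 * exp (- \<alpha> * \<eta>)) \<le> k x * gibbs \<alpha> x"
      proof (cases "x \<in> ball xs s")
        case True
        then have "f x < f xs + \<eta>" "k xs / 2 < k x" using s(2)[of x] by (auto simp: dist_commute)
        then have "k xs / 2 * exp (- \<alpha> * \<eta>) \<le> k x * gibbs \<alpha> x"
          unfolding gibbs_def using k(2)[of xs] k(2)[of x] \<alpha>
          by (intro mult_mono) (auto intro!: mult_left_mono)
        then show ?thesis using True by simp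
      next
        case False
        then show ?thesis using k(2)[of x] gibbs_pos[of \<alpha> x] by simp
      qed
    qed
    finally show "\<kappa> * exp (- \<alpha> * \<eta>) \<le> (\<integral>x. k x * gibbs \<alpha> x \<partial>lborel)" .
  qed
qed

lemma integral_gibbs_pos:
  assumes "continuous_on UNIV k" "\<And>x. k x > 0" "integrable lborel k" "\<alpha> \<ge> 0"
  shows "(\<integral>x. k x * gibbs \<alpha> x \<partial>lborel) > 0"
proof -
  obtain \<kappa> where "\<kappa> > 0" "\<And>\<alpha>. \<alpha> \<ge> 0 \<Longrightarrow> \<kappa> * exp (- \<alpha> * 1) \<le> (\<integral>x. k x * gibbs \<alpha> x \<partial>lborel)"
    using integral_gibbs_lower_bound[OF assms(1-3), of 1] by auto
  then show ?thesis using assms(4) by (meson exp_gt_zero less_le_trans mult_pos_pos)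
qed

text \<open>Near \<open>xs\<close> the function \<open>H\<close> is small relative to
  \<open>k\<close>, as \<open>H xs = 0 < k xs\<close>. Away from \<open>xs\<close> the Gibbs factor
  decays at a faster exponential rate than the denominator can.\<close>

lemma gibbs_ratio_tendsto_0:
  assumes H: "continuous_on UNIV H" "\<And>x. H x \<ge> 0" "integrable lborel H" "H xs = 0"
    and k: "continuous_on UNIV k" "\<And>x. k x > 0" "integrable lborel k"
  shows "((\<lambda>\<alpha>. (\<integral>x. H x * gibbs \<alpha> x \<partial>lborel) / (\<integral>x. k x * gibbs \<alpha> x \<partial>lborel)) \<longlongrightarrow> 0) at_top"
proof (rule tendstoI)
  fix e :: real assume e: "e > 0"
  have "\<forall>\<^sub>F x in nhds xs. H x - e / 2 * k x < 0"
  proof (rule order_tendstoD)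
    have "continuous_on UNIV (\<lambda>x. H x - e / 2 * k x)" using H(1) k(1) by (intro continuous_intros)
    then show "((\<lambda>x. H x - e / 2 * k x) \<longlongrightarrow> H xs - e / 2 * k xs) (nhds xs)"
      by (rule tendsto_nhds_of_continuous_on)
    show "H xs - e / 2 * k xs < 0" using H(4) k(2)[of xs] e by simp
  qed
  then obtain \<rho> where \<rho>: "\<rho> > 0" "\<And>x. dist x xs < \<rho> \<Longrightarrow> H x < e / 2 * k x"
    unfolding eventually_nhds_metric by auto
  obtain \<eta> where \<eta>: "\<eta> > 0" "\<And>x. dist x xs \<ge> \<rho> \<Longrightarrow> f xs + \<eta> \<le> f x"
    using separated[OF \<rho>(1)] by blast
  \<comment> \<open>Half of the gap \<open>\<eta>\<close> is used for the denominator, which leaves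
    a net decay \<open>exp (- \<alpha> * (\<eta> / 2))\<close> for the far part of the
    ratio.\<close>
  obtain \<kappa> where \<kappa>: "\<kappa> > 0"
    "\<And>\<alpha>. \<alpha> \<ge> 0 \<Longrightarrow> \<kappa> * exp (- \<alpha> * (\<eta> / 2)) \<le> (\<integral>x. k x * gibbs \<alpha> x \<partial>lborel)"
    using integral_gibbs_lower_bound[OF k, of "\<eta> / 2"] \<eta>(1) by auto
  define I where "I = (\<integral>x. H x \<partial>lborel)"
  have I: "I \<ge> 0" unfolding I_def using H(2) by simp
  have "((\<lambda>\<alpha>. I / \<kappa> * exp (- \<alpha> * (\<eta> / 2))) \<longlongrightarrow> I / \<kappa> * 0) at_top"
  proof (intro tendsto_mult tendsto_const filterlim_compose[OF exp_at_bot])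
    show "filterlim (\<lambda>\<alpha>. - \<alpha> * (\<eta> / 2)) at_bot at_top"
      using \<eta>(1) filterlim_tendsto_pos_mult_at_bot[OF tendsto_const _ filterlim_uminus_at_bot_at_top,
          of "\<eta> / 2"]
      by (simp add: mult.commute)
  qed
  then have "\<forall>\<^sub>F \<alpha> in at_top. I / \<kappa> * exp (- \<alpha> * (\<eta> / 2)) < e / 2"
    using e by (intro order_tendstoD) auto
  moreover have "\<forall>\<^sub>F \<alpha> :: real in at_top. \<alpha> \<ge> 0" by (rule eventually_ge_at_top)
  ultimately show "\<forall>\<^sub>F \<alpha> in at_top. dist ((\<integral>x. H x * gibbs \<alpha> x \<partial>lborel)
      / (\<integral>x. k x * gibbs \<alpha> x \<partial>lborel)) 0 < e"
  proof eventually_elim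
    case (elim \<alpha>)
    let ?D = "\<integral>x. k x * gibbs \<alpha> x \<partial>lborel" and ?N = "\<integral>x. H x * gibbs \<alpha> x \<partial>lborel"
    have D: "?D > 0" by (rule integral_gibbs_pos[OF k elim(2)])
    have N: "?N \<ge> 0" using H(2) less_imp_le[OF gibbs_pos] by (intro integral_nonneg_AE) auto
    have intk: "integrable lborel (\<lambda>x. k x * gibbs \<alpha> x)"
      and intH: "integrable lborel (\<lambda>x. H x * gibbs \<alpha> x)"
      using integrable_gibbs_mult[OF elim(2)] k(3) H(3) by auto
    \<comment> \<open>The first summand dominates inside the ball of radius \<open>\<rho>\<close>,
      the second outside; both are nonnegative, so the sum dominates everywhere.\<close>
    have "?N \<le> (\<integral>x. e / 2 * (k x * gibbs \<alpha> x) + exp (- \<alpha> * \<eta>) * H x \<partial>lborel)"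
    proof (rule integral_mono[OF intH])
      show "integrable lborel (\<lambda>x. e / 2 * (k x * gibbs \<alpha> x) + exp (- \<alpha> * \<eta>) * H x)"
        using intk H(3) by simp
      fix x
      show "H x * gibbs \<alpha> x \<le> e / 2 * (k x * gibbs \<alpha> x) + exp (- \<alpha> * \<eta>) * H x"
      proof (cases "dist x xs < \<rho>")
        case True
        then have "H x * gibbs \<alpha> x \<le> e / 2 * k x * gibbs \<alpha> x"
          using \<rho>(2) gibbs_pos[of \<alpha> x] by (intro mult_right_mono) (auto intro: less_imp_le)
        moreover have "exp (- \<alpha> * \<eta>) * H x \<ge> 0" using H(2) by simp
        ultimately show ?thesis by (simp add: mult.assoc)
      next
        case False
        then have "f xs + \<eta> \<le> f x" using \<eta>(2) by simp
        then have "gibbs \<alpha> x \<le> exp (- \<alpha> * \<eta>)"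
          unfolding gibbs_def using elim(2) by (auto intro!: mult_left_mono)
        then have "H x * gibbs \<alpha> x \<le> H x * exp (- \<alpha> * \<eta>)"
          using H(2) by (intro mult_left_mono) auto
        moreover have "e / 2 * (k x * gibbs \<alpha> x) \<ge> 0"
          using e k(2)[of x] gibbs_pos[of \<alpha> x] by simp
        ultimately show ?thesis by (simp add: mult.commute)
      qed
    qed
    also have "\<dots> = e / 2 * ?D + exp (- \<alpha> * \<eta>) * I"
      using intk H(3) by (simp add: I_def)
    finally have "?N / ?D \<le> e / 2 + exp (- \<alpha> * \<eta>) * I / ?D"
      using D by (simp add: field_simps)
    also have "exp (- \<alpha> * \<eta>) * I / ?D \<le> exp (- \<alpha> * \<eta>) * I / (\<kappa> * exp (- \<alpha> * (\<eta> / 2)))"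
      using I \<kappa>(1) \<kappa>(2)[OF elim(2)] D by (intro divide_left_mono) auto
    also have "\<dots> = I / \<kappa> * (exp (- \<alpha> * \<eta>) / exp (- \<alpha> * (\<eta> / 2)))" by simp
    also have "exp (- \<alpha> * \<eta>) / exp (- \<alpha> * (\<eta> / 2)) = exp (- \<alpha> * (\<eta> / 2))"
      by (simp add: exp_diff[symmetric])
    finally have "?N / ?D \<le> e / 2 + I / \<kappa> * exp (- \<alpha> * (\<eta> / 2))" by simp
    then have "?N / ?D < e" using elim(1) by linarith
    then show ?case using N D by simp
  qed
qed

section \<open>The consensus map\<close>

text \<open>The point \<open>m\<close> enters only through a term linear in \<open>x - xs\<close>,
  so changing \<open>m\<close> tilts the weight exponentially.\<close>

definition weight :: "real \<Rightarrow> real \<Rightarrow> 'a \<Rightarrow> 'a \<Rightarrow> real" where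
  "weight v \<alpha> m x = exp ((x - xs) \<bullet> (m - xs) / v - (norm (x - xs))\<^sup>2 / (2 * v)) * gibbs \<alpha> x"

text \<open>For \<open>m\<close> within \<open>R\<close> of \<open>xs\<close>, the rates
  \<open>A = R / v\<close> and \<open>A = - R / v\<close> bound the weight from above and below
  independently of \<open>m\<close>. At \<open>xs\<close> the envelope vanishes if
  \<open>j > 0\<close> and equals 1 if \<open>j = 0\<close>.\<close>

definition envelope :: "real \<Rightarrow> real \<Rightarrow> nat \<Rightarrow> 'a \<Rightarrow> real" where
  "envelope v A j x = norm (x - xs) ^ j * exp (A * norm (x - xs) - (norm (x - xs))\<^sup>2 / (2 * v))"

definition gibbs_moment :: "real \<Rightarrow> real \<Rightarrow> real \<Rightarrow> nat \<Rightarrow> real" where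
  "gibbs_moment v \<alpha> A j = (\<integral>x. envelope v A j x * gibbs \<alpha> x \<partial>lborel)"

lemma continuous_on_envelope: "v \<noteq> 0 \<Longrightarrow> continuous_on UNIV (envelope v A j)"
  unfolding envelope_def by (intro continuous_intros) auto

lemma envelope_nonneg: "envelope v A j x \<ge> 0"
  by (simp add: envelope_def)

lemma integrable_envelope: "v > 0 \<Longrightarrow> integrable lborel (envelope v A j)"
  unfolding envelope_def by (rule integrable_norm_power_exp_neg_norm_sq)

lemma integrable_envelope_gibbs:
  "v > 0 \<Longrightarrow> \<alpha> \<ge> 0 \<Longrightarrow> integrable lborel (\<lambda>x. envelope v A j x * gibbs \<alpha> x)"
  by (intro integrable_gibbs_mult integrable_envelope)

lemma gibbs_moment_0_pos: "v > 0 \<Longrightarrow> \<alpha> \<ge> 0 \<Longrightarrow> gibbs_moment v \<alpha> A 0 > 0"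
  unfolding gibbs_moment_def
  by (intro integral_gibbs_pos continuous_on_envelope integrable_envelope)
     (auto simp: envelope_def)

lemma gibbs_moment_nonneg: "gibbs_moment v \<alpha> A j \<ge> 0"
  unfolding gibbs_moment_def
  by (intro integral_nonneg_AE) (auto simp: envelope_nonneg less_imp_le[OF gibbs_pos])

lemma weight_measurable [measurable]: "weight v \<alpha> m \<in> borel_measurable borel"
  unfolding weight_def by measurable

lemma weight_pos: "weight v \<alpha> m x > 0"
  by (simp add: weight_def gibbs_pos)

lemma abs_inner_div_le:
  assumes "v > 0" "m \<in> cball xs R"
  shows "\<bar>(x - xs) \<bullet> (m - xs) / v\<bar> \<le> R / v * norm (x - xs)"
proof -
  have "\<bar>(x - xs) \<bullet> (m - xs)\<bar> \<le> norm (x - xs) * norm (m - xs)"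
    by (rule Cauchy_Schwarz_ineq2)
  also have "\<dots> \<le> norm (x - xs) * R"
    using assms(2) by (intro mult_left_mono) (auto simp: dist_norm norm_minus_commute)
  finally show ?thesis
    using assms(1) by (simp add: divide_right_mono mult.commute)
qed

lemma weight_le:
  assumes "v > 0" "m \<in> cball xs R"
  shows "norm (x - xs) ^ j * weight v \<alpha> m x \<le> envelope v (R / v) j x * gibbs \<alpha> x"
proof -
  have "exp ((x - xs) \<bullet> (m - xs) / v - (norm (x - xs))\<^sup>2 / (2 * v))
      \<le> exp (R / v * norm (x - xs) - (norm (x - xs))\<^sup>2 / (2 * v))"
    using abs_inner_div_le[OF assms, of x] unfolding exp_le_cancel_iff by linarith
  then show ?thesis
    unfolding weight_def envelope_def mult.assoc
    using gibbs_pos[of \<alpha> x] by (intro mult_left_mono mult_right_mono) auto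
qed

lemma weight_ge:
  assumes "v > 0" "m \<in> cball xs R"
  shows "envelope v (- R / v) 0 x * gibbs \<alpha> x \<le> weight v \<alpha> m x"
proof -
  have "exp (- R / v * norm (x - xs) - (norm (x - xs))\<^sup>2 / (2 * v))
      \<le> exp ((x - xs) \<bullet> (m - xs) / v - (norm (x - xs))\<^sup>2 / (2 * v))"
    using abs_inner_div_le[OF assms, of x] unfolding exp_le_cancel_iff minus_divide_left[symmetric]
    by linarith
  then show ?thesis
    unfolding weight_def envelope_def
    using gibbs_pos[of \<alpha> x] by (simp add: mult_right_mono)
qed

lemma integrable_weight:
  assumes "v > 0" "\<alpha> \<ge> 0"
  shows "integrable lborel (weight v \<alpha> m)"
    and "integrable lborel (\<lambda>x. weight v \<alpha> m x *\<^sub>R (x - xs))"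
proof -
  \<comment> \<open>Every \<open>m\<close> lies in some ball about \<open>xs\<close>, and the
    envelope for that radius dominates.\<close>
  have m: "m \<in> cball xs (dist xs m)" by simp
  show "integrable lborel (weight v \<alpha> m)"
    by (rule Bochner_Integration.integrable_bound[OF integrable_envelope_gibbs[OF assms, of "dist xs m / v" 0]])
       (use weight_le[OF assms(1) m, of _ 0] weight_pos[of v \<alpha> m] in
        \<open>auto simp: less_imp_le[OF weight_pos] less_imp_le[OF gibbs_pos] abs_mult
          abs_of_nonneg[OF envelope_nonneg] gibbs_pos abs_of_pos\<close>)
  show "integrable lborel (\<lambda>x. weight v \<alpha> m x *\<^sub>R (x - xs))"
    by (rule Bochner_Integration.integrable_bound[OF integrable_envelope_gibbs[OF assms, of "dist xs m / v" 1]])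
       (use weight_le[OF assms(1) m, of _ 1] in
        \<open>auto simp: abs_mult abs_of_nonneg[OF envelope_nonneg] abs_of_pos[OF gibbs_pos]
          abs_of_pos[OF weight_pos] mult.commute[of "weight _ _ _ _"]\<close>)
qed

lemma integral_weight_ge:
  assumes "v > 0" "\<alpha> \<ge> 0" "m \<in> cball xs R"
  shows "gibbs_moment v \<alpha> (- R / v) 0 \<le> (\<integral>x. weight v \<alpha> m x \<partial>lborel)"
  unfolding gibbs_moment_def
  by (intro integral_mono integrable_envelope_gibbs integrable_weight weight_ge assms)

lemma integral_weight_pos:
  assumes "v > 0" "\<alpha> \<ge> 0"
  shows "(\<integral>x. weight v \<alpha> m x \<partial>lborel) > 0"
  using integral_weight_ge[OF assms, of m "dist xs m"] gibbs_moment_0_pos[OF assms]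
  by (meson less_le_trans mem_cball order_refl)

text \<open>The Gaussian density centred at \<open>m\<close>, times \<open>exp (- \<alpha> f)\<close>, is a multiple of the weight by a
  factor that does not depend on \<open>x\<close> and therefore cancels in the consensus point.\<close>

lemma consensus_map_eq_weighted_mean:
  assumes v: "v > 0" and \<alpha>: "\<alpha> \<ge> 0"
  shows "consensus_map f v \<alpha> m
    = xs + (\<integral>x. weight v \<alpha> m x *\<^sub>R (x - xs) \<partial>lborel) /\<^sub>R (\<integral>x. weight v \<alpha> m x \<partial>lborel)"
proof -
  let ?Z = "\<integral>x. weight v \<alpha> m x \<partial>lborel"
  define c where "c = exp (- \<alpha> * f xs - (norm (m - xs))\<^sup>2 / (2 * v)) / sqrt (2 * pi * v) ^ DIM('a)"
  define p where "p x = exp (- (norm (x - m))\<^sup>2 / (2 * v)) / sqrt (2 * pi * v) ^ DIM('a)" for x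
  have c: "c > 0" using v by (simp add: c_def)
  have [measurable]: "f \<in> borel_measurable borel" by (rule borel_measurable_continuous_onI[OF cont])
  have p: "p x * exp (- \<alpha> * f x) = c * weight v \<alpha> m x" for x
  proof -
    \<comment> \<open>The real variables stand for the squared norm of \<open>x - xs\<close>, the
      inner product, the squared norm of \<open>m - xs\<close>, and \<open>f x\<close>; the local
      \<open>c\<close> shadows the constant defined above.\<close>
    have arith: "- (a - 2 * b + c) / (2 * v) + - \<alpha> * y
        = (- \<alpha> * f xs - c / (2 * v)) + (b / v - a / (2 * v)) + - \<alpha> * (y - f xs)" for a b c y
      using v by (simp add: field_simps)
    have "(norm (x - m))\<^sup>2 = (norm (x - xs))\<^sup>2 - 2 * ((x - xs) \<bullet> (m - xs)) + (norm (m - xs))\<^sup>2"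
      by (simp add: power2_norm_eq_inner inner_diff_left inner_diff_right inner_commute)
    then have "- (norm (x - m))\<^sup>2 / (2 * v) + - \<alpha> * f x
        = (- \<alpha> * f xs - (norm (m - xs))\<^sup>2 / (2 * v))
          + ((x - xs) \<bullet> (m - xs) / v - (norm (x - xs))\<^sup>2 / (2 * v)) + - \<alpha> * (f x - f xs)"
      using arith by simp
    then have "exp (- (norm (x - m))\<^sup>2 / (2 * v)) * exp (- \<alpha> * f x)
        = exp (- \<alpha> * f xs - (norm (m - xs))\<^sup>2 / (2 * v)) * weight v \<alpha> m x"
      unfolding weight_def gibbs_def exp_add[symmetric] mult.assoc[symmetric] by simp
    then show ?thesis by (simp add: p_def c_def)
  qed
  have pnn: "p x \<ge> 0" and [measurable]: "p \<in> borel_measurable borel" for x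
    using v by (auto simp: p_def[abs_def])
  have "gaussian m v = density lborel (\<lambda>x. ennreal (p x))"
    by (simp add: gaussian_def p_def)
  then have "(\<integral>x. exp (- \<alpha> * f x) *\<^sub>R x \<partial>gaussian m v) = (\<integral>x. (c * weight v \<alpha> m x) *\<^sub>R x \<partial>lborel)"
    and "(\<integral>x. exp (- \<alpha> * f x) \<partial>gaussian m v) = c * ?Z"
    using pnn p by (simp_all add: integral_density)
  moreover have "(\<integral>x. (c * weight v \<alpha> m x) *\<^sub>R x \<partial>lborel)
      = c *\<^sub>R (\<integral>x. weight v \<alpha> m x *\<^sub>R x \<partial>lborel)"
    unfolding scaleR_scaleR[symmetric] by (rule integral_scaleR_right)
  \<comment> \<open>Centring splits off \<open>?Z *\<^sub>R xs\<close>, which normalisation turns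
    into the summand \<open>xs\<close>.\<close>
  moreover have "(\<integral>x. weight v \<alpha> m x *\<^sub>R x \<partial>lborel)
      = (\<integral>x. weight v \<alpha> m x *\<^sub>R (x - xs) \<partial>lborel) + ?Z *\<^sub>R xs"
  proof -
    have "(\<integral>x. weight v \<alpha> m x *\<^sub>R x \<partial>lborel)
        = (\<integral>x. weight v \<alpha> m x *\<^sub>R (x - xs) + weight v \<alpha> m x *\<^sub>R xs \<partial>lborel)"
      by (simp add: scaleR_diff_right)
    also have "\<dots> = (\<integral>x. weight v \<alpha> m x *\<^sub>R (x - xs) \<partial>lborel) + ?Z *\<^sub>R xs"
      using integrable_weight[OF assms, of m]
      by (subst Bochner_Integration.integral_add) auto
    finally show ?thesis .
  qed
  moreover have "inverse (c * ?Z) * c = inverse ?Z" "inverse (c * ?Z) * (c * ?Z) = 1"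
    using c integral_weight_pos[OF assms, of m] by (simp_all add: field_simps)
  ultimately show ?thesis
    by (simp only: consensus_map_def consensus_point_def scaleR_scaleR scaleR_add_right scaleR_one
        add.commute)
qed

section \<open>Bounds on the consensus map, uniform on balls\<close>

lemma dist_consensus_map_minimizer_le:
  assumes "v > 0" "\<alpha> \<ge> 0" "m \<in> cball xs R"
  shows "dist (consensus_map f v \<alpha> m) xs \<le> gibbs_moment v \<alpha> (R / v) 1 / gibbs_moment v \<alpha> (- R / v) 0"
proof -
  let ?Z = "\<integral>x. weight v \<alpha> m x \<partial>lborel" and ?N = "\<integral>x. weight v \<alpha> m x *\<^sub>R (x - xs) \<partial>lborel"
  have "norm ?N \<le> (\<integral>x. norm (weight v \<alpha> m x *\<^sub>R (x - xs)) \<partial>lborel)"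
    by (rule integral_norm_bound)
  also have "\<dots> \<le> gibbs_moment v \<alpha> (R / v) 1"
    unfolding gibbs_moment_def
  proof (rule integral_mono)
    show "norm (weight v \<alpha> m x *\<^sub>R (x - xs)) \<le> envelope v (R / v) 1 x * gibbs \<alpha> x" for x
      using weight_le[OF assms(1,3), of x 1 \<alpha>] weight_pos[of v \<alpha> m x]
      by (simp add: mult.commute)
  qed (intro integrable_norm integrable_weight integrable_envelope_gibbs assms)+
  finally have "norm ?N / ?Z \<le> gibbs_moment v \<alpha> (R / v) 1 / gibbs_moment v \<alpha> (- R / v) 0"
    by (intro frac_le gibbs_moment_nonneg integral_weight_ge gibbs_moment_0_pos assms)
  then show ?thesis
    using integral_weight_pos[OF assms(1,2), of m]
    by (simp add: consensus_map_eq_weighted_mean[OF assms(1,2)] dist_norm divide_inverse mult.commute)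
qed

text \<open>The exponents differ by the inner product of \<open>x - xs\<close> with
  \<open>m' - m\<close>, divided by \<open>v\<close>. The mean value estimate turns this into an
  extra factor \<open>norm (x - xs)\<close>, raising the envelope's order from 0 to 1.\<close>

lemma abs_weight_diff_le:
  assumes "v > 0" "m \<in> cball xs R" "m' \<in> cball xs R"
  shows "\<bar>weight v \<alpha> m' x - weight v \<alpha> m x\<bar>
    \<le> dist m m' / v * (envelope v (R / v) 1 x * gibbs \<alpha> x)"
proof -
  define a where "a n = (x - xs) \<bullet> (n - xs) / v - (norm (x - xs))\<^sup>2 / (2 * v)" for n
  define c where "c = R / v * norm (x - xs) - (norm (x - xs))\<^sup>2 / (2 * v)"
  have "a m \<le> c" "a m' \<le> c"
    unfolding a_def c_def
    using abs_inner_div_le[OF assms(1,2), of x] abs_inner_div_le[OF assms(1,3), of x] by linarith+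
  then have "\<bar>exp (a m') - exp (a m)\<bar> \<le> \<bar>a m' - a m\<bar> * exp c" by (intro abs_exp_diff_le)
  also have "\<bar>a m' - a m\<bar> \<le> norm (x - xs) * dist m m' / v"
  proof -
    have "a m' - a m = (x - xs) \<bullet> (m' - m) / v"
      by (simp add: a_def diff_divide_distrib[symmetric] inner_diff_right)
    then have "\<bar>a m' - a m\<bar> = \<bar>(x - xs) \<bullet> (m' - m)\<bar> / v" using assms(1) by simp
    also have "\<dots> \<le> norm (x - xs) * norm (m' - m) / v"
      using assms(1) by (intro divide_right_mono Cauchy_Schwarz_ineq2) auto
    finally show ?thesis by (simp add: dist_norm norm_minus_commute)
  qed
  finally have "\<bar>exp (a m') - exp (a m)\<bar> \<le> norm (x - xs) * dist m m' / v * exp c"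
    by (simp add: mult_right_mono)
  then have "\<bar>exp (a m') - exp (a m)\<bar> * gibbs \<alpha> x
      \<le> norm (x - xs) * dist m m' / v * exp c * gibbs \<alpha> x"
    using gibbs_pos[of \<alpha> x] by (intro mult_right_mono) auto
  moreover have "\<bar>weight v \<alpha> m' x - weight v \<alpha> m x\<bar> = \<bar>exp (a m') - exp (a m)\<bar> * gibbs \<alpha> x"
    using gibbs_pos[of \<alpha> x]
    by (simp add: weight_def a_def left_diff_distrib[symmetric] abs_mult)
  ultimately show ?thesis by (simp add: envelope_def c_def mult_ac)
qed

text \<open>With \<open>t\<close> the centred image of \<open>m\<close>, the weight of \<open>m\<close> annihilates \<open>x - xs - t\<close>, so only the
  difference of the two weights contributes to the difference of the images.\<close>

lemma dist_consensus_map_le: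
  assumes v: "v > 0" and \<alpha>: "\<alpha> \<ge> 0" and m: "m \<in> cball xs R" and m': "m' \<in> cball xs R"
  defines "D \<equiv> gibbs_moment v \<alpha> (- R / v) 0"
  shows "dist (consensus_map f v \<alpha> m) (consensus_map f v \<alpha> m')
    \<le> (gibbs_moment v \<alpha> (R / v) 2 / D + (gibbs_moment v \<alpha> (R / v) 1 / D)\<^sup>2) / v * dist m m'"
proof -
  define t where "t = consensus_map f v \<alpha> m - xs"
  let ?w = "weight v \<alpha>" and ?Z = "\<lambda>n. \<integral>x. weight v \<alpha> n x \<partial>lborel"
    and ?N = "\<lambda>n. \<integral>x. weight v \<alpha> n x *\<^sub>R (x - xs) \<partial>lborel"
  define K1 where "K1 = gibbs_moment v \<alpha> (R / v) 1"
  define K2 where "K2 = gibbs_moment v \<alpha> (R / v) 2"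
  define q where "q = dist m m' / v"
  have q: "q \<ge> 0" using v by (simp add: q_def)
  have D: "D > 0" unfolding D_def by (rule gibbs_moment_0_pos[OF v \<alpha>])
  have Z: "?Z n > 0" for n by (rule integral_weight_pos[OF v \<alpha>])
  have ZD: "D \<le> ?Z m'" unfolding D_def by (rule integral_weight_ge[OF v \<alpha> m'])
  have t: "norm t \<le> K1 / D"
    using dist_consensus_map_minimizer_le[OF v \<alpha> m] by (simp add: t_def D_def K1_def dist_norm)
  have K: "K1 \<ge> 0" "K2 \<ge> 0" by (auto simp: K1_def K2_def gibbs_moment_nonneg)
  have Nm: "?N m = ?Z m *\<^sub>R t"
    using Z[of m] by (simp add: t_def consensus_map_eq_weighted_mean[OF v \<alpha>])
  note int = integrable_weight[OF v \<alpha>]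
  have int': "integrable lborel (\<lambda>x. ?w n x *\<^sub>R (x - xs - t))" for n
    unfolding scaleR_diff_right[of _ "_ - xs" t] using int by auto
  have N: "(\<integral>x. ?w n x *\<^sub>R (x - xs - t) \<partial>lborel) = ?N n - ?Z n *\<^sub>R t" for n
    unfolding scaleR_diff_right[of _ "_ - xs" t] using int by simp
  have "consensus_map f v \<alpha> m' - consensus_map f v \<alpha> m = ?N m' /\<^sub>R ?Z m' - t"
    by (simp add: t_def consensus_map_eq_weighted_mean[OF v \<alpha>, of m'])
  also have "\<dots> = (?N m' - ?Z m' *\<^sub>R t) /\<^sub>R ?Z m'"
    using Z[of m'] by (simp add: scaleR_diff_right)
  \<comment> \<open>The subtracted bracket is zero by \<open>Nm\<close>; it brings the difference of
    the two weights under one integral.\<close>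
  also have "?N m' - ?Z m' *\<^sub>R t = (?N m' - ?Z m' *\<^sub>R t) - (?N m - ?Z m *\<^sub>R t)"
    by (simp add: Nm)
  also have "\<dots> = (\<integral>x. ?w m' x *\<^sub>R (x - xs - t) - ?w m x *\<^sub>R (x - xs - t) \<partial>lborel)"
    by (subst Bochner_Integration.integral_diff) (simp_all only: int' N)
  finally have eq: "consensus_map f v \<alpha> m' - consensus_map f v \<alpha> m
      = (\<integral>x. ?w m' x *\<^sub>R (x - xs - t) - ?w m x *\<^sub>R (x - xs - t) \<partial>lborel) /\<^sub>R ?Z m'" (is "_ = ?J /\<^sub>R _") .
  have "norm ?J \<le> (\<integral>x. norm (?w m' x *\<^sub>R (x - xs - t) - ?w m x *\<^sub>R (x - xs - t)) \<partial>lborel)"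
    by (rule integral_norm_bound)
  also have "\<dots> \<le> (\<integral>x. q * (envelope v (R / v) 2 x * gibbs \<alpha> x)
      + q * norm t * (envelope v (R / v) 1 x * gibbs \<alpha> x) \<partial>lborel)"
  proof (rule integral_mono)
    show "integrable lborel (\<lambda>x. norm (?w m' x *\<^sub>R (x - xs - t) - ?w m x *\<^sub>R (x - xs - t)))"
      by (intro integrable_norm Bochner_Integration.integrable_diff int')
    show "integrable lborel (\<lambda>x. q * (envelope v (R / v) 2 x * gibbs \<alpha> x)
        + q * norm t * (envelope v (R / v) 1 x * gibbs \<alpha> x))"
      by (intro Bochner_Integration.integrable_add integrable_mult_right integrable_envelope_gibbs v \<alpha>)
    fix x
    have "norm (?w m' x *\<^sub>R (x - xs - t) - ?w m x *\<^sub>R (x - xs - t))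
        = \<bar>?w m' x - ?w m x\<bar> * norm (x - xs - t)"
      by (simp add: scaleR_diff_left[symmetric])
    also have "\<dots> \<le> q * (envelope v (R / v) 1 x * gibbs \<alpha> x) * (norm (x - xs) + norm t)"
      unfolding q_def using abs_weight_diff_le[OF v m m', of \<alpha> x] envelope_nonneg[of v "R / v" 1 x] v
        less_imp_le[OF gibbs_pos[of \<alpha> x]]
      by (intro mult_mono norm_triangle_ineq4) auto
    \<comment> \<open>The factor \<open>norm (x - xs)\<close> raises the order once more, which is
      where the second moment comes from.\<close>
    also have "\<dots> = q * (envelope v (R / v) 2 x * gibbs \<alpha> x)
        + q * norm t * (envelope v (R / v) 1 x * gibbs \<alpha> x)"
      by (simp add: envelope_def algebra_simps power2_eq_square)
    finally show "norm (?w m' x *\<^sub>R (x - xs - t) - ?w m x *\<^sub>R (x - xs - t))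
        \<le> q * (envelope v (R / v) 2 x * gibbs \<alpha> x)
        + q * norm t * (envelope v (R / v) 1 x * gibbs \<alpha> x)" .
  qed
  also have "\<dots> = q * K2 + q * norm t * K1"
    unfolding K1_def K2_def gibbs_moment_def
    using integrable_envelope_gibbs[OF v \<alpha>] by simp
  also have "\<dots> \<le> q * K2 + q * (K1 / D) * K1"
    using t q K by (intro add_left_mono mult_right_mono mult_left_mono) auto
  finally have "norm ?J / ?Z m' \<le> (q * K2 + q * (K1 / D) * K1) / D"
    using ZD D q K by (intro frac_le) auto
  also have "\<dots> = (K2 / D + (K1 / D)\<^sup>2) / v * dist m m'"
    using D v by (simp add: q_def field_simps power2_eq_square)
  finally show ?thesis
    unfolding K1_def[symmetric] K2_def[symmetric] dist_commute[of "consensus_map f v \<alpha> m"]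
      dist_norm[of "consensus_map f v \<alpha> m'"] eq
    using Z[of m'] by (simp add: divide_inverse mult.commute)
qed

section \<open>Contraction and fixed point for large \<alpha>\<close>

lemma gibbs_moment_ratio_tendsto_0:
  assumes "v > 0" "j > 0"
  shows "((\<lambda>\<alpha>. gibbs_moment v \<alpha> A j / gibbs_moment v \<alpha> B 0) \<longlongrightarrow> 0) at_top"
  \<comment> \<open>The rates \<open>A\<close> and \<open>B\<close> may differ: the Laplace argument
    asks that the numerator's envelope vanish at \<open>xs\<close> and that the denominator's be
    positive.\<close>
  unfolding gibbs_moment_def
  using assms
  by (intro gibbs_ratio_tendsto_0 continuous_on_envelope integrable_envelope)
     (auto simp: envelope_def)

text \<open>\<open>R\<close>, \<open>q\<close> and \<open>e\<close> are fixed before \<alpha>, so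
  the ball may be large while both constants are small. The Lipschitz bound is built from moment
  ratios of orders 1 and 2, and these tend to 0.\<close>

lemma consensus_map_contraction:
  assumes v: "v > 0" and q: "q > 0" and e: "e > 0"
  shows "\<forall>\<^sub>F \<alpha> in at_top. \<forall>m\<in>cball xs R.
    dist (consensus_map f v \<alpha> m) xs \<le> e \<and>
    (\<forall>m'\<in>cball xs R. dist (consensus_map f v \<alpha> m) (consensus_map f v \<alpha> m') \<le> q * dist m m')"
proof -
  let ?r = "\<lambda>j \<alpha>. gibbs_moment v \<alpha> (R / v) j / gibbs_moment v \<alpha> (- R / v) 0"
  have "((\<lambda>\<alpha>. (?r 2 \<alpha> + (?r 1 \<alpha>)\<^sup>2) / v) \<longlongrightarrow> (0 + 0\<^sup>2) / v) at_top"
    using v by (intro tendsto_intros gibbs_moment_ratio_tendsto_0) auto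
  then have "\<forall>\<^sub>F \<alpha> in at_top. (?r 2 \<alpha> + (?r 1 \<alpha>)\<^sup>2) / v < q"
    using q by (intro order_tendstoD) auto
  moreover have "\<forall>\<^sub>F \<alpha> in at_top. ?r 1 \<alpha> < e"
    using e v by (intro order_tendstoD(2)[OF gibbs_moment_ratio_tendsto_0]) auto
  moreover have "\<forall>\<^sub>F \<alpha> :: real in at_top. \<alpha> \<ge> 0" by (rule eventually_ge_at_top)
  ultimately show ?thesis
  proof eventually_elim
    case (elim \<alpha>)
    have "dist (consensus_map f v \<alpha> m) xs \<le> e" if "m \<in> cball xs R" for m
      using dist_consensus_map_minimizer_le[OF v elim(3) that] elim(2) by linarith
    moreover have "dist (consensus_map f v \<alpha> m) (consensus_map f v \<alpha> m') \<le> q * dist m m'"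
      if "m \<in> cball xs R" "m' \<in> cball xs R" for m m'
      using dist_consensus_map_le[OF v elim(3) that]
        mult_right_mono[OF less_imp_le[OF elim(1)] zero_le_dist[of m m']] by linarith
    ultimately show ?case by blast
  qed
qed

text \<open>Existence in a small ball with uniqueness in a large one makes the fixed point
  independent of the radius once \<alpha> is large.\<close>

lemma consensus_map_fixed_point:
  assumes v: "v > 0" and r: "0 < r" and R: "0 < R"
  shows "\<forall>\<^sub>F \<alpha> in at_top. \<exists>m\<in>cball xs r. consensus_map f v \<alpha> m = m \<and>
    (\<forall>m'\<in>cball xs R. consensus_map f v \<alpha> m' = m' \<longrightarrow> m' = m)"
proof -
  \<comment> \<open>In \<open>min r R\<close>, the bound by \<open>R\<close> gives a self-map for
    Banach's theorem; the bound by \<open>r\<close> then places the fixed point, being its own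
    image, in the smaller ball.\<close>
  have "\<forall>\<^sub>F \<alpha> in at_top. \<forall>m\<in>cball xs R. dist (consensus_map f v \<alpha> m) xs \<le> min r R \<and>
    (\<forall>m'\<in>cball xs R. dist (consensus_map f v \<alpha> m) (consensus_map f v \<alpha> m') \<le> 1 / 2 * dist m m')"
    using r R by (intro consensus_map_contraction[OF v]) auto
  then show ?thesis
  proof eventually_elim
    case *: (elim \<alpha>)
    let ?T = "consensus_map f v \<alpha>"
    have "\<exists>!m\<in>cball xs R. ?T m = m"
    proof (rule Banach_fix)
      show "Topological_Spaces.complete (cball xs R)" by (simp add: complete_eq_closed)
      show "cball xs R \<noteq> {}" using R by simp
      show "?T ` cball xs R \<subseteq> cball xs R" using * by (auto simp: dist_commute[of xs "?T _"])
      show "dist (?T x) (?T y) \<le> 1 / 2 * dist x y" if "x \<in> cball xs R" "y \<in> cball xs R" for x y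
        using bspec[OF conjunct2[OF bspec[OF * that(1)]] that(2)] .
    qed auto
    then obtain m where m: "m \<in> cball xs R" "?T m = m"
      and uniq: "\<And>m'. m' \<in> cball xs R \<Longrightarrow> ?T m' = m' \<Longrightarrow> m' = m"
      by (metis (no_types, lifting))
    have "m \<in> cball xs r" using conjunct1[OF bspec[OF * m(1)]] unfolding m(2) by (simp add: dist_commute)
    then show ?case using m(2) uniq by blast
  qed
qed

end

section \<open>Application to functions of quadratic growth\<close>

lemma strict_minimizer_of_growth:
  fixes f :: "'a::euclidean_space \<Rightarrow> real"
  assumes cont: "continuous_on UNIV f" and min: "\<And>x. f xs \<le> f x"
    and uniq: "\<And>y. f y = f xs \<Longrightarrow> y = xs"
    and c: "c > 0" and M: "M > 0" and growth: "\<And>x. norm x \<ge> M \<Longrightarrow> c * (norm x)\<^sup>2 \<le> f x - f xs"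
  shows "strict_minimizer f xs"
proof
  fix \<rho> :: real assume \<rho>: "\<rho> > 0"
  \<comment> \<open>On this compact set a minimum is attained, and uniqueness of the minimiser makes
    it strictly larger than \<open>f xs\<close>. Beyond radius \<open>M\<close> the growth bound
    gives the gap \<open>c * M\<^sup>2\<close>.\<close>
  let ?K = "cball 0 M - ball xs \<rho>"
  obtain \<eta> where \<eta>: "\<eta> > 0" "\<And>x. x \<in> ?K \<Longrightarrow> f xs + \<eta> \<le> f x"
  proof (cases "?K = {}")
    case True
    show ?thesis by (rule that[of 1], simp) (use True in blast)+
  next
    case False
    have "compact ?K" by (intro compact_diff) auto
    then obtain z where z: "z \<in> ?K" "\<And>x. x \<in> ?K \<Longrightarrow> f z \<le> f x"
      using continuous_attains_inf[OF _ False continuous_on_subset[OF cont]] by blast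
    have "f z \<noteq> f xs" using z(1) uniq[of z] \<rho> by auto
    then have "f z > f xs" using min[of z] by simp
    then show ?thesis using z(2) by (intro that[of "f z - f xs"]) simp_all
  qed
  have "f xs + min \<eta> (c * M\<^sup>2) \<le> f x" if "dist x xs \<ge> \<rho>" for x
  proof (cases "norm x \<le> M")
    case True
    then show ?thesis using \<eta>(2)[of x] that by (auto simp: dist_commute)
  next
    case False
    then have "c * M\<^sup>2 \<le> c * (norm x)\<^sup>2" using c M by (intro mult_left_mono power_mono) auto
    then show ?thesis using growth[of x] False by simp
  qed
  then show "\<exists>\<eta>>0. \<forall>x. dist x xs \<ge> \<rho> \<longrightarrow> f xs + \<eta> \<le> f x"
    using \<eta>(1) c M by (intro exI[of _ "min \<eta> (c * M\<^sup>2)"]) auto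
qed (use cont min in auto)

lemma consensus_hopping_Suc:
  "consensus_hopping f \<sigma> \<alpha> x\<^sub>0 (Suc k) = consensus_map f (\<sigma>\<^sup>2) \<alpha> (consensus_hopping f \<sigma> \<alpha> x\<^sub>0 k)"
  by (simp add: consensus_map_def)

theorem corollary4p2:
  fixes f :: "real ^ 'd \<Rightarrow> real"
    and xs x\<^sub>0 :: "real ^ 'd"
    and L\<^sub>f c\<^sub>l c\<^sub>u M lam \<delta> :: real
  assumes "continuous_on UNIV f"
    and "\<forall>x. f xs \<le> f x"
    and "\<forall>y. f y = f xs \<longrightarrow> y = xs"
    and "L\<^sub>f > 0"
    and "\<forall>x y. \<bar>f x - f y\<bar> \<le> L\<^sub>f * (1 + norm x + norm y) * norm (x - y)"
    and "c\<^sub>l > 0" and "c\<^sub>u > 0" and "M > 0"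
    and "\<forall>x. f x - f xs \<le> c\<^sub>u * ((norm x)\<^sup>2 + 1)"
    and "\<forall>x. norm x \<ge> M \<longrightarrow> c\<^sub>l * (norm x)\<^sup>2 \<le> f x - f xs"
    and "lam > 0" and "\<delta> > 0"
  shows "\<exists>\<mu>inf :: real \<Rightarrow> real ^ 'd.
    (\<forall>r>0. \<forall>\<^sub>F \<alpha> in at_top.
        \<mu>inf \<alpha> \<in> cball xs r \<and>
        consensus_map f (\<delta>\<^sup>2 / (2 * lam)) \<alpha> (\<mu>inf \<alpha>) = \<mu>inf \<alpha> \<and>
        (\<forall>m \<in> cball xs r. consensus_map f (\<delta>\<^sup>2 / (2 * lam)) \<alpha> m = m \<longrightarrow> m = \<mu>inf \<alpha>)) \<and>
    (\<forall>\<gamma>\<in>{0<..<1}. \<forall>\<^sub>F \<alpha> in at_top. \<exists>C>0. \<forall>k::nat.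
        wasserstein2
          (gaussian (consensus_hopping f (\<delta> / sqrt (2 * lam)) \<alpha> x\<^sub>0 k) (\<delta>\<^sup>2 / (2 * lam)))
          (gaussian (\<mu>inf \<alpha>) (\<delta>\<^sup>2 / (2 * lam)))
        \<le> ennreal (C * \<gamma> ^ k))"
proof -
  define v where "v = \<delta>\<^sup>2 / (2 * lam)"
  define \<sigma> where "\<sigma> = \<delta> / sqrt (2 * lam)"
  have v: "v > 0" and \<sigma>: "\<sigma>\<^sup>2 = v"
    using assms(11,12) by (simp_all add: v_def \<sigma>_def power_divide)
  interpret strict_minimizer f xs
    using assms(1-3,6,8,10) by (intro strict_minimizer_of_growth[of f xs c\<^sub>l M]) blast+
  \<comment> \<open>The choice must precede the radius \<open>r\<close>, so the reference radius 1
    is fixed. For small \<alpha> the value may be arbitrary.\<close>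
  define \<mu> where "\<mu> \<alpha> = (SOME m. m \<in> cball xs 1 \<and> consensus_map f v \<alpha> m = m)" for \<alpha>
  have fixpoint: "\<forall>\<^sub>F \<alpha> in at_top. \<mu> \<alpha> \<in> cball xs r \<and> consensus_map f v \<alpha> (\<mu> \<alpha>) = \<mu> \<alpha> \<and>
      (\<forall>m\<in>cball xs r. consensus_map f v \<alpha> m = m \<longrightarrow> m = \<mu> \<alpha>)" if r: "r > 0" for r
  proof -
    \<comment> \<open>The radii \<open>min r 1\<close> and \<open>max r 1\<close> place the fixed
      point in both balls and make it unique in both, so it agrees with the chosen
      \<open>\<mu> \<alpha>\<close>.\<close>
    have "\<forall>\<^sub>F \<alpha> in at_top. \<exists>m\<in>cball xs (min r 1). consensus_map f v \<alpha> m = m \<and>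
        (\<forall>m'\<in>cball xs (max r 1). consensus_map f v \<alpha> m' = m' \<longrightarrow> m' = m)"
      using r by (intro consensus_map_fixed_point[OF v]) auto
    then show ?thesis
    proof eventually_elim
      case (elim \<alpha>)
      then obtain m where m: "m \<in> cball xs (min r 1)" "consensus_map f v \<alpha> m = m"
        "\<And>m'. m' \<in> cball xs (max r 1) \<Longrightarrow> consensus_map f v \<alpha> m' = m' \<Longrightarrow> m' = m" by blast
      have "m \<in> cball xs 1 \<and> consensus_map f v \<alpha> m = m" using m by auto
      then have "\<mu> \<alpha> \<in> cball xs 1 \<and> consensus_map f v \<alpha> (\<mu> \<alpha>) = \<mu> \<alpha>"
        unfolding \<mu>_def by (rule someI)
      then have "\<mu> \<alpha> = m" by (intro m(3)) auto
      then show ?case using m by auto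
    qed
  qed
  have rate: "\<forall>\<^sub>F \<alpha> in at_top. \<exists>C>0. \<forall>k::nat.
      wasserstein2 (gaussian (consensus_hopping f \<sigma> \<alpha> x\<^sub>0 k) v) (gaussian (\<mu> \<alpha>) v)
      \<le> ennreal (C * \<gamma> ^ k)" if \<gamma>: "0 < \<gamma>" "\<gamma> < 1" for \<gamma>
  proof -
    \<comment> \<open>The ball contains the starting point; adding 1 keeps \<open>R\<close> positive
      when \<open>x\<^sub>0 = xs\<close>. The threshold for \<alpha> thus depends on
      \<open>x\<^sub>0\<close> and \<open>\<gamma>\<close>.\<close>
    define R where "R = dist xs x\<^sub>0 + 1"
    have R: "R > 0" by (simp add: R_def add_nonneg_pos)
    have "\<forall>\<^sub>F \<alpha> in at_top. \<forall>m\<in>cball xs R. dist (consensus_map f v \<alpha> m) xs \<le> R \<and>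
        (\<forall>m'\<in>cball xs R. dist (consensus_map f v \<alpha> m) (consensus_map f v \<alpha> m') \<le> \<gamma> * dist m m')"
      by (rule consensus_map_contraction[OF v \<gamma>(1) R])
    then show ?thesis using fixpoint[OF R]
    proof eventually_elim
      case (elim \<alpha>)
      have \<mu>: "\<mu> \<alpha> \<in> cball xs R" "consensus_map f v \<alpha> (\<mu> \<alpha>) = \<mu> \<alpha>"
        using elim(2) by blast+
      let ?x = "consensus_hopping f \<sigma> \<alpha> x\<^sub>0"
      \<comment> \<open>Membership in the ball is carried along because the contraction holds only
        there. Adding 1 keeps the constant positive when \<open>x\<^sub>0\<close> is itself the
        fixed point.\<close>
      have *: "?x k \<in> cball xs R \<and> dist (?x k) (\<mu> \<alpha>) \<le> (dist x\<^sub>0 (\<mu> \<alpha>) + 1) * \<gamma> ^ k" for k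
      proof (induction k)
        case 0
        then show ?case by (simp add: R_def)
      next
        case (Suc k)
        have x: "?x (Suc k) = consensus_map f v \<alpha> (?x k)"
          unfolding consensus_hopping_Suc \<sigma> ..
        have "dist (?x (Suc k)) (\<mu> \<alpha>) \<le> \<gamma> * dist (?x k) (\<mu> \<alpha>)"
          unfolding x
          using bspec[OF conjunct2[OF bspec[OF elim(1) conjunct1[OF Suc]]] \<mu>(1)] unfolding \<mu>(2) .
        also have "\<dots> \<le> \<gamma> * ((dist x\<^sub>0 (\<mu> \<alpha>) + 1) * \<gamma> ^ k)"
          using Suc \<gamma> by (intro mult_left_mono) auto
        finally have "dist (?x (Suc k)) (\<mu> \<alpha>) \<le> (dist x\<^sub>0 (\<mu> \<alpha>) + 1) * \<gamma> ^ Suc k"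
          by (simp only: power_Suc mult_ac)
        moreover have "?x (Suc k) \<in> cball xs R"
          unfolding x mem_cball dist_commute[of xs]
          by (rule conjunct1[OF bspec[OF elim(1) conjunct1[OF Suc]]])
        ultimately show ?case by blast
      qed
      have "wasserstein2 (gaussian (?x k) v) (gaussian (\<mu> \<alpha>) v)
          \<le> ennreal ((dist x\<^sub>0 (\<mu> \<alpha>) + 1) * \<gamma> ^ k)" for k
        by (rule order_trans[OF wasserstein2_gaussian_le_dist[OF v] ennreal_leI]) (use * in blast)
      then show ?case
        by (intro exI[of _ "dist x\<^sub>0 (\<mu> \<alpha>) + 1"]) (auto intro: add_nonneg_pos)
    qed
  qed
  show ?thesis
    unfolding v_def[symmetric] \<sigma>_def[symmetric] using fixpoint rate
    by (intro exI[of _ \<mu>] conjI allI impI ballI) (simp_all only: greaterThanLessThan_iff)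
qed

end
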